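(* Let $P^\ast(n)$ be defined by $\sum_{n\ge 0}P^\ast(n)q^n=f_1^4f_5^4$. Then for all integers $k\geq 0$ and $n\geq -1$, \begin{align*} P^\ast(2^{4k}n+2^{4k+1}-1)&\equiv 0\pmod{2^{6k}},\\ P^\ast(2^{4k+1}n+2^{4k+2}-1)&\equiv 0\pmod{2^{6k+2}},\\ P^\ast(2^{4k+2}n+2^{4k+3}-1)&\equiv 0\pmod{2^{6k+3}},\\ P^\ast(2^{4k+3}n+2^{4k+4}-1)&\equiv 0\pmod{2^{6k+6}},\\ P^\ast(2^{4k+4}n+3\cdot 2^{4k+3}-1)&=0. \end{align*}
   Context: For a positive integer $m$, $f_m:=\prod_{n=1}^\infty(1-q^{mn})$, regarded as a formal power series in $q$ (or for $|q|<1$). *)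

theory Defs
  imports "HOL-Analysis.Analysis" "HOL-Computational_Algebra.Formal_Power_Series" "HOL-Number_Theory.Cong"
begin

text \<open>
  The infinite product is the library's \<^const>\<open>prodinf\<close>, taken in the usual (\<open>q\<close>-adic)
  topology on formal power series; lemma \<open>euler_f_has_prod\<close> below shows that it converges.
  The library's index starts at 0, hence \<open>Suc n\<close>.
\<close>

definition euler_f :: "nat \<Rightarrow> int fps" where
  "euler_f m = (\<Prod>n. 1 - fps_X ^ (m * Suc n))"

definition P_star :: "nat \<Rightarrow> int" where
  "P_star n = fps_nth (euler_f 1 ^ 4 * euler_f 5 ^ 4) n"

lemma euler_f_has_prod:
  assumes "m > 0"
  shows "(\<lambda>n. 1 - fps_X ^ (m * Suc n) :: int fps) has_prod euler_f m"
proof -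
  let ?p = "\<lambda>n. \<Prod>i\<le>n. (1 - fps_X ^ (m * Suc i) :: int fps)"
  define L where "L = Abs_fps (\<lambda>j. fps_nth (?p j) j)"
  have stable: "fps_nth (?p n) j = fps_nth (?p j) j" if "j \<le> n" for n j
    using that
  proof (induction n rule: dec_induct)
    case (step n)
    have "Suc n \<le> m * Suc (Suc n)"
      using assms by (cases m) auto
    hence lt: "j < m * Suc (Suc n)"
      using step.hyps by linarith
    have "?p (Suc n) = ?p n - ?p n * fps_X ^ (m * Suc (Suc n))"
      by (simp add: algebra_simps)
    hence "fps_nth (?p (Suc n)) j = fps_nth (?p n) j"
      using lt by (simp only: fps_sub_nth fps_X_power_mult_right_nth) simp
    thus ?case using step.IH by simp
  qed simp
  have lim: "?p \<longlonglongrightarrow> L"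
  proof (rule tendsto_fpsI)
    fix j
    show "\<forall>\<^sub>F n in sequentially. fps_nth (?p n) j = fps_nth L j"
      using eventually_ge_at_top[of j] by eventually_elim (simp only: L_def fps_nth_Abs_fps, rule stable)
  qed
  have "fps_nth L 0 = 1"
    using assms by (simp add: L_def)
  hence "L \<noteq> 0" by auto
  hence "(\<lambda>n. 1 - fps_X ^ (m * Suc n) :: int fps) has_prod L"
    using lim by (simp add: has_prod_def raw_has_prod_def)
  moreover from this have "L = euler_f m"
    unfolding euler_f_def by (rule has_prod_unique)
  ultimately show ?thesis by simp
qed

end

theory Submission
  imports Defs "HOL-Computational_Algebra.Formal_Laurent_Series" "HOL-Library.Nat_Bijection"
begin

text \<open>
  Write \<open>c n\<close> for the coefficient of \<open>q\<^sup>n\<close> in \<open>q f\<^sub>1\<^sup>4 f\<^sub>5\<^sup>4\<close>, the newform of weight 4 and level 5. Everything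
  follows from the Hecke relation \<open>c (2n) = - 4 c n - 8 c (n/2)\<close>: its characteristic roots \<open>- 2 \<plusminus> 2i\<close>
  satisfy \<open>(- 2 \<plusminus> 2i)\<^sup>4 = - 64\<close>, so \<open>c (16n) = - 64 c n\<close>, and already \<open>c (8n) = - 64 c (n/2)\<close>, which
  vanishes for odd \<open>n\<close>.

  The Hecke relation is proved without modular forms. By Gauss, \<open>f\<^sub>1\<^sup>2 = \<phi>(-q) f\<^sub>2\<close>, and
  \<open>\<phi>(-q)\<^sup>2 = \<phi>(q\<^sup>2)\<^sup>2 - 4q \<psi>(q\<^sup>4)\<^sup>2\<close>, which isolates the odd part of \<open>f\<^sub>1\<^sup>4 f\<^sub>5\<^sup>4\<close>. It is then
  evaluated with \<open>f\<^sub>1 f\<^sub>5 = \<psi>(q\<^sup>2) \<phi>(q\<^sup>5) - q \<phi>(q) \<psi>(q\<^sup>1\<^sup>0)\<close>, \<open>\<psi>(q)\<^sup>2 = \<phi>(q) \<psi>(q\<^sup>2)\<close> and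
  \<open>f\<^sub>1 \<psi>(q) = f\<^sub>2\<^sup>2\<close>. The product formulas are limits of finite identities of Shanks, and the
  others come from bijections between lattice points.
\<close>

section \<open>Finite product-sum identities of Shanks\<close>

text \<open>This is (q;q)_n / (q;q)_s, written without division so that it makes sense in every
  commutative ring.\<close>

definition qprod :: "'a::comm_ring_1 \<Rightarrow> nat \<Rightarrow> nat \<Rightarrow> 'a" where
  "qprod q s n = (\<Prod>k\<in>{s<..n}. 1 - q ^ k)"

lemma qprod_self [simp]: "qprod q n n = 1"
  by (simp add: qprod_def)

lemma qprod_Suc_right: "s \<le> n \<Longrightarrow> qprod q s (Suc n) = qprod q s n * (1 - q ^ Suc n)"
proof -
  assume "s \<le> n"
  then have "{s<..Suc n} = insert (Suc n) {s<..n}" by auto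
  then show ?thesis by (simp add: qprod_def mult.commute)
qed

lemma qprod_Suc_left: "s < n \<Longrightarrow> qprod q s n = (1 - q ^ Suc s) * qprod q (Suc s) n"
proof -
  assume "s < n"
  then have "{s<..n} = insert (Suc s) {Suc s<..n}" by auto
  then show ?thesis by (simp add: qprod_def)
qed

lemma sum_int_symmetric_Suc:
  fixes f :: "int \<Rightarrow> 'a::comm_monoid_add"
  shows "sum f {- int (Suc n)..int (Suc n)} = sum f {- int n..int n} + (f (int (Suc n)) + f (- int (Suc n)))"
proof -
  have "{- int (Suc n)..int (Suc n)} = insert (int (Suc n)) (insert (- int (Suc n)) {- int n..int n})"
    by auto
  then show ?thesis by (simp add: ac_simps)
qed

text \<open>(-1)^j for an exponent that may be negative.\<close>

definition int_sgn :: "int \<Rightarrow> int" where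
  "int_sgn j = (if even j then 1 else -1)"

text \<open>The generalized pentagonal numbers: \<open>j\<close> and \<open>- j\<close> give the two
  families.\<close>

definition pent :: "int \<Rightarrow> int" where
  "pent j = j * (3 * j + 1) div 2"

lemma pent_double: "2 * pent j = j * (3 * j + 1)"
  unfolding pent_def by (rule dvd_mult_div_cancel) auto

lemma triangle_double: "2 * triangle n = n * Suc n"
  by (induction n) auto

text \<open>Passing from \<open>n\<close> to \<open>Suc n\<close> changes each old summand by a
  telescoping difference. What survives is \<open>K (Suc n)\<close> and the new summand, which are
  the terms \<open>j = - int (Suc n)\<close> and \<open>j = int (Suc n)\<close>.\<close>

lemma shanks_pentagonal:
  fixes q :: "'a::comm_ring_1"
  shows "(\<Sum>s\<le>n. (-1) ^ s * qprod q s n * q ^ (s * n + triangle s)) =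
         (\<Sum>j=- int n..int n. of_int (int_sgn j) * q ^ nat (pent j))"
proof (induction n)
  case 0
  then show ?case by (simp add: int_sgn_def pent_def)
next
  case (Suc n)
  \<comment> \<open>\<open>K (Suc s)\<close> is the part of \<open>?R (Suc n) s\<close> that comes
    from \<open>- q ^ Suc n\<close> in the new factor of \<open>qprod\<close>;
    \<open>K 0 = 0\<close> leaves no lower boundary term.\<close>
  define K where "K = (\<lambda>s. case s of 0 \<Rightarrow> 0 | Suc t \<Rightarrow>
    - ((-1) ^ t * qprod q t n * q ^ (Suc t * Suc n + triangle t)))"
  let ?R = "\<lambda>n s. (-1) ^ s * qprod q s n * q ^ (s * n + triangle s)"
  have step: "?R (Suc n) s = ?R n s + (K (Suc s) - K s)" if "s \<le> n" for s
  proof (cases s)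
    case 0
    then show ?thesis by (simp add: K_def qprod_Suc_right algebra_simps)
  next
    case (Suc t)
    with that have D: "qprod q t n = (1 - q ^ Suc t) * qprod q (Suc t) n"
      by (intro qprod_Suc_left) auto
    from that show ?thesis
      unfolding Suc by (simp add: K_def D qprod_Suc_right algebra_simps power_add)
  qed
  have "(\<Sum>s\<le>Suc n. ?R (Suc n) s) = (\<Sum>s\<le>n. ?R (Suc n) s) + ?R (Suc n) (Suc n)"
    by simp
  also have "(\<Sum>s\<le>n. ?R (Suc n) s) = (\<Sum>s\<le>n. ?R n s + (K (Suc s) - K s))"
    by (intro sum.cong refl step) auto
  also have "\<dots> = (\<Sum>s\<le>n. ?R n s) + (\<Sum>s\<le>n. K (Suc s) - K s)"
    by (rule sum.distrib)
  also have "(\<Sum>s\<le>n. K (Suc s) - K s) = K (Suc n)"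
    unfolding lessThan_Suc_atMost [symmetric] sum_lessThan_telescope by (simp add: K_def)
  finally have 1: "(\<Sum>s\<le>Suc n. ?R (Suc n) s) = (\<Sum>s\<le>n. ?R n s) + (K (Suc n) + ?R (Suc n) (Suc n))"
    by (simp add: add.assoc)
  have e1: "nat (pent (int (Suc n))) = Suc n * Suc n + triangle (Suc n)"
  proof -
    have "2 * pent (int (Suc n)) = int (2 * (Suc n * Suc n) + 2 * triangle (Suc n))"
      unfolding pent_double triangle_double by (simp add: algebra_simps)
    then show ?thesis by linarith
  qed
  have e2: "nat (pent (- int (Suc n))) = Suc n * Suc n + triangle n"
  proof -
    have "2 * pent (- int (Suc n)) = int (2 * (Suc n * Suc n) + 2 * triangle n)"
      unfolding pent_double triangle_double by (simp add: algebra_simps)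
    then show ?thesis by linarith
  qed
  have sg: "of_int (int_sgn (int (Suc n))) = ((-1) ^ Suc n :: 'a)"
    "of_int (int_sgn (- int (Suc n))) = ((-1) ^ Suc n :: 'a)"
    by (auto simp: int_sgn_def)
  show ?case
    unfolding 1 Suc sum_int_symmetric_Suc e1 e2 sg by (simp add: K_def)
qed

text \<open>Telescoping again, but the product on the right also grows, so the old sum is first
  multiplied by \<open>1 + q ^ Suc n\<close>.\<close>

lemma shanks_square:
  fixes q :: "'a::comm_ring_1"
  shows "(\<Sum>s\<le>n. (-1) ^ s * qprod q s n * (\<Prod>k<s. 1 + q ^ k) * q ^ (s * Suc n)) =
         (\<Prod>k=1..n. 1 + q ^ k) * (\<Sum>j=- int n..int n. of_int (int_sgn j) * q ^ nat (j\<^sup>2))"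
proof (induction n)
  case 0
  then show ?case by (simp add: int_sgn_def)
next
  case (Suc n)
  define B where "B = (\<lambda>s. \<Prod>k<s. 1 + q ^ k)"
  have B_Suc: "B (Suc s) = B s * (1 + q ^ s)" for s by (simp add: B_def)
  \<comment> \<open>The factor \<open>k = 0\<close> of \<open>B\<close> is 2, which pays for the two
    equal powers at \<open>j = int (Suc n)\<close> and \<open>j = - int (Suc n)\<close>.\<close>
  have B_eq: "B (Suc m) = 2 * (\<Prod>k=1..m. 1 + q ^ k)" for m
    by (induction m) (simp_all add: B_def ac_simps)
  define K where "K = (\<lambda>s. case s of 0 \<Rightarrow> 0 | Suc t \<Rightarrow>
    - ((-1) ^ t * qprod q t n * B (Suc t) * q ^ (Suc t * Suc n)))"
  let ?R = "\<lambda>n s. (-1) ^ s * qprod q s n * B s * q ^ (s * Suc n)"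
  have step: "?R (Suc n) s = (1 + q ^ Suc n) * ?R n s + (K (Suc s) - K s)" if "s \<le> n" for s
  proof (cases s)
    case 0
    then show ?thesis by (simp add: K_def qprod_Suc_right B_def algebra_simps)
  next
    case (Suc t)
    with that have D: "qprod q t n = (1 - q ^ Suc t) * qprod q (Suc t) n"
      by (intro qprod_Suc_left) auto
    from that show ?thesis
      unfolding Suc by (simp add: K_def D qprod_Suc_right B_Suc algebra_simps power_add)
  qed
  have "(\<Sum>s\<le>Suc n. ?R (Suc n) s) = (\<Sum>s\<le>n. ?R (Suc n) s) + ?R (Suc n) (Suc n)"
    by simp
  also have "(\<Sum>s\<le>n. ?R (Suc n) s) = (\<Sum>s\<le>n. (1 + q ^ Suc n) * ?R n s + (K (Suc s) - K s))"
    by (intro sum.cong refl step) auto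
  also have "\<dots> = (1 + q ^ Suc n) * (\<Sum>s\<le>n. ?R n s) + (\<Sum>s\<le>n. K (Suc s) - K s)"
    unfolding sum.distrib sum_distrib_left ..
  also have "(\<Sum>s\<le>n. K (Suc s) - K s) = K (Suc n)"
    unfolding lessThan_Suc_atMost [symmetric] sum_lessThan_telescope by (simp add: K_def)
  finally have 1: "(\<Sum>s\<le>Suc n. ?R (Suc n) s) =
      (1 + q ^ Suc n) * (\<Sum>s\<le>n. ?R n s) + (K (Suc n) + ?R (Suc n) (Suc n))"
    by (simp add: add.assoc)
  have 2: "K (Suc n) + ?R (Suc n) (Suc n) = (-1) ^ Suc n * q ^ (Suc n * Suc n) * B (Suc (Suc n))"
    by (simp add: K_def B_Suc algebra_simps power_add)
  have e: "nat ((int (Suc n))\<^sup>2) = Suc n * Suc n" "nat ((- int (Suc n))\<^sup>2) = Suc n * Suc n"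
    unfolding power2_minus of_nat_power [symmetric] nat_int by (simp_all add: power2_eq_square)
  have sg: "of_int (int_sgn (int (Suc n))) = ((-1) ^ Suc n :: 'a)"
    "of_int (int_sgn (- int (Suc n))) = ((-1) ^ Suc n :: 'a)"
    by (auto simp: int_sgn_def)
  have P: "(\<Prod>k=1..Suc n. 1 + q ^ k) = (1 + q ^ Suc n) * (\<Prod>k=1..n. 1 + q ^ k)"
    by (simp add: mult.commute)
  have IH: "(\<Sum>s\<le>n. ?R n s) =
      (\<Prod>k=1..n. 1 + q ^ k) * (\<Sum>j=- int n..int n. of_int (int_sgn j) * q ^ nat (j\<^sup>2))"
    using Suc unfolding B_def .
  have "(\<Sum>s\<le>Suc n. ?R (Suc n) s) = (\<Prod>k=1..Suc n. 1 + q ^ k) *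
      (\<Sum>j=- int (Suc n)..int (Suc n). of_int (int_sgn j) * q ^ nat (j\<^sup>2))"
    unfolding 1 2 unfolding IH B_eq sum_int_symmetric_Suc e sg P
    by (simp add: algebra_simps del: prod.cl_ivl_Suc)
  then show ?case unfolding B_def .
qed

text \<open>The same telescoping with prefactor \<open>1 - q ^ (2 * n + 1)\<close>. The exponents on
  the right are the first 2n triangular numbers.\<close>

lemma shanks_triangular:
  fixes q :: "'a::comm_ring_1"
  shows "(\<Sum>s<n. qprod (q\<^sup>2) s n * (\<Prod>k<s. 1 - q ^ (2 * k + 1)) * q ^ (s * (2 * n + 1))) =
         (\<Prod>k<n. 1 - q ^ (2 * k + 1)) * (\<Sum>j=1 - int n..int n. q ^ nat (j * (2 * j - 1)))"
proof (induction n)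
  case 0
  then show ?case by simp
next
  case (Suc n)
  define B where "B = (\<lambda>s. \<Prod>k<s. 1 - q ^ (2 * k + 1))"
  have B_Suc: "B (Suc s) = B s * (1 - q ^ (2 * s + 1))" for s by (simp add: B_def)
  have B_0: "B 0 = 1" by (simp add: B_def)
  define K where "K = (\<lambda>s. case s of 0 \<Rightarrow> 0 | Suc t \<Rightarrow>
    qprod (q\<^sup>2) t n * B (Suc t) * q ^ (Suc t * (2 * n + 1)))"
  let ?R = "\<lambda>n s. qprod (q\<^sup>2) s n * B s * q ^ (s * (2 * n + 1))"
  have step: "?R (Suc n) s = (1 - q ^ (2 * n + 1)) * ?R n s + (K (Suc s) - K s)" if "s \<le> n" for s
  proof (cases s)
    case 0
    then show ?thesis
      by (simp add: K_def qprod_Suc_right B_Suc B_0 algebra_simps power_add power2_eq_square power_mult_distrib mult_2 mult_2_right)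
  next
    case (Suc t)
    with that have D: "qprod (q * q) t n = (1 - (q * q) ^ Suc t) * qprod (q * q) (Suc t) n"
      by (intro qprod_Suc_left) auto
    from that show ?thesis
      unfolding Suc by (simp add: K_def D qprod_Suc_right B_Suc algebra_simps power_add power2_eq_square power_mult_distrib mult_2 mult_2_right)
  qed
  have "(\<Sum>s<Suc n. ?R (Suc n) s) = (\<Sum>s\<le>n. (1 - q ^ (2 * n + 1)) * ?R n s + (K (Suc s) - K s))"
    unfolding lessThan_Suc_atMost by (intro sum.cong refl step) auto
  also have "\<dots> = (1 - q ^ (2 * n + 1)) * (\<Sum>s\<le>n. ?R n s) + (\<Sum>s\<le>n. K (Suc s) - K s)"
    unfolding sum.distrib sum_distrib_left ..
  also have "(\<Sum>s\<le>n. K (Suc s) - K s) = K (Suc n)"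
    unfolding lessThan_Suc_atMost [symmetric] sum_lessThan_telescope by (simp add: K_def)
  \<comment> \<open>The sum for \<open>n\<close> stops before \<open>s = n\<close>, so this summand
    is split off; with \<open>K (Suc n)\<close> it produces the two new exponents, at
    \<open>j = - int n\<close> and \<open>j = int (Suc n)\<close>.\<close>
  also have "(\<Sum>s\<le>n. ?R n s) = (\<Sum>s<n. ?R n s) + ?R n n"
    by (simp add: lessThan_Suc_atMost [symmetric])
  finally have 1: "(\<Sum>s<Suc n. ?R (Suc n) s) =
      (1 - q ^ (2 * n + 1)) * ((\<Sum>s<n. ?R n s) + ?R n n) + K (Suc n)" .
  have S: "(\<Sum>j=1 - int (Suc n)..int (Suc n). q ^ nat (j * (2 * j - 1))) =
     (\<Sum>j=1 - int n..int n. q ^ nat (j * (2 * j - 1))) + (q ^ (Suc n * (2 * n + 1)) + q ^ (n * (2 * n + 1)))"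
  proof -
    have "{1 - int (Suc n)..int (Suc n)} = insert (int (Suc n)) (insert (- int n) {1 - int n..int n})"
      by auto
    moreover have "int (Suc n) * (2 * int (Suc n) - 1) = int (Suc n * (2 * n + 1))"
      "- int n * (2 * - int n - 1) = int (n * (2 * n + 1))"
      by (simp_all add: algebra_simps)
    then have "nat (int (Suc n) * (2 * int (Suc n) - 1)) = Suc n * (2 * n + 1)"
      "nat (- int n * (2 * - int n - 1)) = n * (2 * n + 1)"
      by (simp_all only: nat_int)
    ultimately show ?thesis by (simp add: ac_simps del: of_nat_Suc mult_minus_left)
  qed
  have IH: "(\<Sum>s<n. ?R n s) = B n * (\<Sum>j=1 - int n..int n. q ^ nat (j * (2 * j - 1)))"
    using Suc unfolding B_def .
  have "(\<Sum>s<Suc n. ?R (Suc n) s) = B (Suc n) *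
      (\<Sum>j=1 - int (Suc n)..int (Suc n). q ^ nat (j * (2 * j - 1)))"
    unfolding 1 IH S by (simp add: K_def B_Suc algebra_simps)
  then show ?case unfolding B_def .
qed

section \<open>Generating functions of weighted families\<close>

text \<open>Exponents are integers so that they can be quadratic forms; negative ones are discarded.\<close>

definition gf :: "'a set \<Rightarrow> ('a \<Rightarrow> int) \<Rightarrow> ('a \<Rightarrow> int) \<Rightarrow> int fps" where
  "gf S e w = Abs_fps (\<lambda>N. \<Sum>i\<in>{i \<in> S. e i = int N}. w i)"

text \<open>Ensures that \<open>gf\<close> loses nothing: no exponent is negative, and no
  coefficient is a sum over an infinite set, which would be 0 by default.\<close>

definition proper_on :: "'a set \<Rightarrow> ('a \<Rightarrow> int) \<Rightarrow> bool" where
  "proper_on S e \<longleftrightarrow> (\<forall>i\<in>S. 0 \<le> e i) \<and> (\<forall>N. finite {i \<in> S. e i = int N})"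

lemma gf_reindex:
  assumes "inj_on h T" "\<And>b. b \<in> T \<Longrightarrow> h b \<in> S" "\<And>a. a \<in> S \<Longrightarrow> \<exists>b\<in>T. a = h b"
    and e: "\<And>b. b \<in> T \<Longrightarrow> e (h b) = e' b" and w: "\<And>b. b \<in> T \<Longrightarrow> w (h b) = w' b"
  shows "gf S e w = gf T e' w'"
  unfolding gf_def
proof (intro arg_cong [of _ _ Abs_fps] ext)
  fix N
  have "{i \<in> S. e i = int N} = h ` {i \<in> T. e' i = int N}"
    using assms(2-4) by force
  moreover have "inj_on h {i \<in> T. e' i = int N}"
    using assms(1) by (rule inj_on_subset) auto
  ultimately show "(\<Sum>i\<in>{i \<in> S. e i = int N}. w i) = (\<Sum>i\<in>{i \<in> T. e' i = int N}. w' i)"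
    by (simp add: sum.reindex w)
qed

lemma gf_Un:
  assumes "proper_on (S \<union> T) e" "S \<inter> T = {}"
  shows "gf (S \<union> T) e w = gf S e w + gf T e w"
proof (rule fps_ext)
  fix N
  have *: "{i \<in> S \<union> T. e i = int N} = {i \<in> S. e i = int N} \<union> {i \<in> T. e i = int N}"
    by auto
  have "finite {i \<in> S \<union> T. e i = int N}"
    using assms(1) by (simp add: proper_on_def)
  then show "fps_nth (gf (S \<union> T) e w) N = fps_nth (gf S e w + gf T e w) N"
    unfolding gf_def fps_add_nth fps_nth_Abs_fps *
    by (intro sum.union_disjoint) (use assms(2) in auto)
qed

lemma gf_uminus: "gf S e (\<lambda>i. - w i) = - gf S e w"
  by (simp add: gf_def fps_eq_iff sum_negf)

lemma gf_shift:
  assumes "proper_on S e"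
  shows "fps_X ^ k * gf S e w = gf S (\<lambda>i. e i + int k) w"
proof (rule fps_ext)
  fix N
  show "fps_nth (fps_X ^ k * gf S e w) N = fps_nth (gf S (\<lambda>i. e i + int k) w) N"
  proof (cases "N < k")
    case True
    then have *: "{i \<in> S. e i + int k = int N} = {}"
      using assms by (force simp: proper_on_def)
    show ?thesis
      unfolding gf_def fps_nth_Abs_fps * using True by (simp add: fps_X_power_mult_nth)
  next
    case False
    then have "{i \<in> S. e i + int k = int N} = {i \<in> S. e i = int (N - k)}"
      by auto
    then show ?thesis
      using False by (simp add: gf_def fps_X_power_mult_nth)
  qed
qed

lemma gf_compose_X_power:
  assumes "k > 0"
  shows "gf S e w oo fps_X ^ k = gf S (\<lambda>i. int k * e i) w"
proof (rule fps_ext)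
  fix N
  show "fps_nth (gf S e w oo fps_X ^ k) N = fps_nth (gf S (\<lambda>i. int k * e i) w) N"
  proof (cases "k dvd N")
    case True
    then obtain M where M: "N = k * M" by blast
    have "{i \<in> S. int k * e i = int N} = {i \<in> S. e i = int M}"
      using assms by (auto simp: M)
    then show ?thesis
      using assms by (simp add: gf_def fps_nth_compose_X_power M)
  next
    case False
    then have *: "{i \<in> S. int k * e i = int N} = {}"
      by (metis (mono_tags, lifting) dvd_triv_left empty_Collect_eq int_dvd_int_iff)
    show ?thesis
      unfolding gf_def fps_nth_Abs_fps * using False by (simp add: fps_nth_compose_X_power)
  qed
qed

lemma gf_mult:
  assumes "proper_on S e" "proper_on T d"
  shows "gf S e v * gf T d w = gf (S \<times> T) (\<lambda>(i, j). e i + d j) (\<lambda>(i, j). v i * w j)"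
proof (rule fps_ext)
  fix N
  let ?A = "\<lambda>k. {i \<in> S. e i = int k}" and ?B = "\<lambda>k. {j \<in> T. d j = int (N - k)}"
  have fin: "\<forall>k\<in>{0..N}. finite (?A k \<times> ?B k)"
    using assms unfolding proper_on_def by blast
  have eq: "{p \<in> S \<times> T. (\<lambda>(i, j). e i + d j) p = int N} = (\<Union>k\<in>{0..N}. ?A k \<times> ?B k)"
  proof (intro set_eqI iffI)
    fix p assume p: "p \<in> {p \<in> S \<times> T. (\<lambda>(i, j). e i + d j) p = int N}"
    obtain i j where ij: "p = (i, j)" by (cases p)
    with p have "i \<in> S" "j \<in> T" "e i + d j = int N" "0 \<le> e i" "0 \<le> d j"
      using assms by (auto simp: proper_on_def)
    then have "p \<in> ?A (nat (e i)) \<times> ?B (nat (e i))" "nat (e i) \<in> {0..N}"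
      by (auto simp: ij)
    then show "p \<in> (\<Union>k\<in>{0..N}. ?A k \<times> ?B k)" by blast
  next
    fix p assume "p \<in> (\<Union>k\<in>{0..N}. ?A k \<times> ?B k)"
    then show "p \<in> {p \<in> S \<times> T. (\<lambda>(i, j). e i + d j) p = int N}"
      by (auto simp: of_nat_diff)
  qed
  have "fps_nth (gf S e v * gf T d w) N = (\<Sum>k=0..N. sum v (?A k) * sum w (?B k))"
    by (simp add: fps_mult_nth gf_def)
  also have "\<dots> = (\<Sum>k=0..N. \<Sum>(i, j)\<in>?A k \<times> ?B k. v i * w j)"
    by (simp add: sum_product sum.cartesian_product)
  also have "\<dots> = (\<Sum>(i, j)\<in>(\<Union>k\<in>{0..N}. ?A k \<times> ?B k). v i * w j)"
    by (rule sum.UNION_disjoint [OF _ fin, symmetric]) auto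
  finally show "fps_nth (gf S e v * gf T d w) N =
      fps_nth (gf (S \<times> T) (\<lambda>(i, j). e i + d j) (\<lambda>(i, j). v i * w j)) N"
    unfolding gf_def fps_nth_Abs_fps eq .
qed

lemma proper_on_Times:
  assumes "proper_on S e" "proper_on T d"
  shows "proper_on (S \<times> T) (\<lambda>(i, j). e i + d j)"
proof -
  have "finite {p \<in> S \<times> T. (\<lambda>(i, j). e i + d j) p = int N}" for N
  proof (rule finite_subset)
    show "{p \<in> S \<times> T. (\<lambda>(i, j). e i + d j) p = int N} \<subseteq>
      (\<Union>k\<le>N. {i \<in> S. e i = int k}) \<times> (\<Union>k\<le>N. {j \<in> T. d j = int k})"
    proof
      fix p assume p: "p \<in> {p \<in> S \<times> T. (\<lambda>(i, j). e i + d j) p = int N}"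
      obtain i j where ij: "p = (i, j)" by (cases p)
      with p have "i \<in> S" "j \<in> T" "e i + d j = int N" "0 \<le> e i" "0 \<le> d j"
        using assms by (auto simp: proper_on_def)
      then have "i \<in> {i \<in> S. e i = int (nat (e i))}" "nat (e i) \<le> N"
        "j \<in> {j \<in> T. d j = int (nat (d j))}" "nat (d j) \<le> N"
        by auto
      then show "p \<in> (\<Union>k\<le>N. {i \<in> S. e i = int k}) \<times> (\<Union>k\<le>N. {j \<in> T. d j = int k})"
        unfolding ij by blast
    qed
  qed (use assms in \<open>auto simp: proper_on_def\<close>)
  then show ?thesis
    using assms by (auto simp: proper_on_def)
qed

text \<open>Coefficient \<open>N\<close> is final once \<open>n > N\<close>, as \<open>A n\<close>
  then holds every index of exponent \<open>N\<close>. The guard \<open>0 < n\<close> admits the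
  windows \<open>{1 - int n..int n}\<close>, empty at \<open>n = 0\<close>.\<close>

lemma gf_tendsto:
  fixes e :: "'a \<Rightarrow> int"
  assumes "proper_on UNIV e" "\<And>n. finite (A n)" "\<And>n i. 0 < n \<Longrightarrow> e i \<le> int n \<Longrightarrow> i \<in> A n"
  shows "(\<lambda>n. \<Sum>i\<in>A n. of_int (w i) * fps_X ^ nat (e i)) \<longlonglongrightarrow> gf UNIV e w"
proof (rule tendsto_fpsI)
  fix N
  show "\<forall>\<^sub>F n in sequentially. fps_nth (\<Sum>i\<in>A n. of_int (w i) * fps_X ^ nat (e i)) N = fps_nth (gf UNIV e w) N"
    using eventually_gt_at_top [of N]
  proof eventually_elim
    case (elim n)
    have "fps_nth (\<Sum>i\<in>A n. of_int (w i) * fps_X ^ nat (e i)) N =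
        (\<Sum>i\<in>A n. if e i = int N then w i else 0)"
      unfolding fps_sum_nth
    proof (intro sum.cong refl)
      fix i
      have "0 \<le> e i" using assms(1) by (simp add: proper_on_def)
      then show "fps_nth (of_int (w i) * fps_X ^ nat (e i)) N = (if e i = int N then w i else 0)"
        by (auto simp: fps_of_int [symmetric] fps_X_power_nth)
    qed
    also have "\<dots> = (\<Sum>i\<in>{i. e i = int N}. w i)"
    proof -
      have "{i \<in> A n. e i = int N} = {i. e i = int N}"
        using assms(3) elim by force
      then show ?thesis
        using assms(2) by (simp flip: sum.inter_filter)
    qed
    finally show ?case by (simp add: gf_def)
  qed
qed

lemma tendsto_mult_fps:
  fixes f g :: "'b \<Rightarrow> 'a::ring_1 fps"
  assumes "(f \<longlongrightarrow> a) F" "(g \<longlongrightarrow> b) F"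
  shows "((\<lambda>x. f x * g x) \<longlongrightarrow> a * b) F"
proof (rule tendsto_fpsI)
  fix n
  have "\<forall>\<^sub>F x in F. \<forall>k\<in>{..n}. fps_nth (f x) k = fps_nth a k"
    by (subst eventually_ball_finite_distrib) (use assms in \<open>auto simp: tendsto_fps_iff\<close>)
  moreover have "\<forall>\<^sub>F x in F. \<forall>k\<in>{..n}. fps_nth (g x) k = fps_nth b k"
    by (subst eventually_ball_finite_distrib) (use assms in \<open>auto simp: tendsto_fps_iff\<close>)
  ultimately show "\<forall>\<^sub>F x in F. fps_nth (f x * g x) n = fps_nth (a * b) n"
    by eventually_elim (simp add: fps_mult_nth)
qed

section \<open>Theta functions and eta products\<close>

lemma fps_X_power_power_nat: "(fps_X ^ m) ^ nat e = (fps_X ^ nat (int m * e) :: 'a::comm_ring_1 fps)"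
  by (simp add: nat_mult_distrib power_mult)

text \<open>For Shanks sums: summands with \<open>s > 0\<close> carry a power of at least
  \<open>n\<close> and die out coefficientwise, so the limit is that of the summand
  \<open>s = 0\<close>.\<close>

lemma tendsto_sum_X_power:
  fixes c :: "nat \<Rightarrow> nat \<Rightarrow> 'a::comm_ring_1 fps"
  assumes "(\<lambda>n. c n 0) \<longlonglongrightarrow> L" "\<And>n. d n 0 = 0" "\<And>n s. 0 < s \<Longrightarrow> n \<le> d n s"
    and "\<And>n. finite (A n)" "\<And>n. 0 < n \<Longrightarrow> 0 \<in> A n"
  shows "(\<lambda>n. \<Sum>s\<in>A n. c n s * fps_X ^ d n s) \<longlonglongrightarrow> L"
proof (rule tendsto_fpsI)
  fix N
  have "\<forall>\<^sub>F n in sequentially. fps_nth (c n 0) N = fps_nth L N"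
    using assms(1) by (simp add: tendsto_fps_iff)
  then show "\<forall>\<^sub>F n in sequentially. fps_nth (\<Sum>s\<in>A n. c n s * fps_X ^ d n s) N = fps_nth L N"
    using eventually_gt_at_top [of N]
  proof eventually_elim
    case (elim n)
    have "(\<Sum>s\<in>A n. c n s * fps_X ^ d n s) = c n 0 + (\<Sum>s\<in>A n - {0}. c n s * fps_X ^ d n s)"
      using elim assms(2,4,5) by (subst sum.remove [of _ 0]) auto
    moreover have "fps_nth (\<Sum>s\<in>A n - {0}. c n s * fps_X ^ d n s) N = 0"
      unfolding fps_sum_nth
    proof (intro sum.neutral ballI)
      fix s assume "s \<in> A n - {0}"
      then have "N < d n s"
        using assms(3) [of s n] elim by auto
      then show "fps_nth (c n s * fps_X ^ d n s) N = 0"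
        by (simp add: fps_X_power_mult_right_nth)
    qed
    ultimately show ?case
      using elim by simp
  qed
qed

lemma qprod_tendsto_euler_f:
  assumes "m > 0"
  shows "(\<lambda>n. qprod (fps_X ^ m) 0 n) \<longlonglongrightarrow> euler_f m"
proof -
  have "qprod (fps_X ^ m) 0 n = (\<Prod>i<n. 1 - fps_X ^ (m * Suc i) :: int fps)" for n
    unfolding qprod_def by (rule prod.reindex_bij_witness [of _ Suc "\<lambda>k. k - 1"])
      (auto simp: power_mult [symmetric])
  then show ?thesis
    using has_prod_imp_tendsto' [OF euler_f_has_prod [OF assms]] by simp
qed

lemma abs_le_square: "\<bar>j\<bar> \<le> j\<^sup>2" for j :: int
  using self_le_power [of "\<bar>j\<bar>" 2] by (cases "j = 0") auto

lemma abs_le_pent: "\<bar>j\<bar> \<le> pent j"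
  using pent_double [of j] abs_le_square [of j] by (simp add: algebra_simps power2_eq_square)

lemma abs_le_hexagonal: "\<bar>j\<bar> \<le> j * (2 * j - 1)" for j :: int
  using abs_le_square [of j] by (simp add: algebra_simps power2_eq_square)

lemma abs_le_scaled:
  fixes j e :: int
  assumes "m > 0" "\<bar>j\<bar> \<le> e"
  shows "\<bar>j\<bar> \<le> int m * e"
proof -
  have "1 * e \<le> int m * e" using assms by (intro mult_right_mono) auto
  with assms show ?thesis by simp
qed

text \<open>The slack of 1 is for the exponents \<open>j * (j + 1)\<close>, which vanish at
  \<open>j = - 1\<close>.\<close>

lemma proper_onI_abs:
  fixes e :: "int \<Rightarrow> int"
  assumes "\<And>j. 0 \<le> e j" "\<And>j. \<bar>j\<bar> \<le> e j + 1"
  shows "proper_on UNIV e"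
proof -
  have "{j. e j = int N} \<subseteq> {- int N - 1..int N + 1}" for N
  proof
    fix j assume "j \<in> {j. e j = int N}"
    then show "j \<in> {- int N - 1..int N + 1}"
      using assms(2) [of j] by auto
  qed
  then have "finite {j. e j = int N}" for N
    by (rule finite_subset) simp
  then show ?thesis using assms(1) by (auto simp: proper_on_def)
qed

lemma proper_on_scaled:
  assumes "m > 0" "\<And>j. \<bar>j\<bar> \<le> e j"
  shows "proper_on UNIV (\<lambda>j. int m * e j)"
proof (rule proper_onI_abs)
  fix j
  have "\<bar>j\<bar> \<le> int m * e j" using assms by (rule abs_le_scaled)
  then show "0 \<le> int m * e j" "\<bar>j\<bar> \<le> int m * e j + 1" by linarith+
qed

text \<open>Both sides are limits of the finite sums in \<open>shanks_pentagonal\<close> at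
  \<open>fps_X ^ m\<close>.\<close>

theorem euler_pentagonal:
  assumes "m > 0"
  shows "euler_f m = gf UNIV (\<lambda>j. int m * pent j) int_sgn"
proof (rule LIMSEQ_unique)
  let ?q = "fps_X ^ m :: int fps"
  show "(\<lambda>n. \<Sum>j=- int n..int n. of_int (int_sgn j) * ?q ^ nat (pent j)) \<longlonglongrightarrow> euler_f m"
    unfolding shanks_pentagonal [symmetric]
    unfolding power_mult [symmetric]
  proof (rule tendsto_sum_X_power)
    fix n s :: nat assume s: "0 < s"
    then have "1 * (1 * n) \<le> m * (s * n + triangle s)"
      using assms by (intro mult_mono) (auto intro: trans_le_add1)
    then show "n \<le> m * (s * n + triangle s)" by simp
  qed (use qprod_tendsto_euler_f [OF assms] in auto)
  show "(\<lambda>n. \<Sum>j=- int n..int n. of_int (int_sgn j) * ?q ^ nat (pent j)) \<longlonglongrightarrow>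
      gf UNIV (\<lambda>j. int m * pent j) int_sgn"
    unfolding fps_X_power_power_nat
  proof (rule gf_tendsto)
    fix n :: nat and i assume "0 < n" and "int m * pent i \<le> int n"
    then show "i \<in> {- int n..int n}"
      using abs_le_scaled [OF assms abs_le_pent [of i]] by auto
  qed (use assms in \<open>auto intro: proper_on_scaled abs_le_pent\<close>)
qed

text \<open>In Ramanujan's notation \<open>theta m\<close> is \<phi>(q^m),
  \<open>theta_alt m\<close> is \<phi>(-q^m) and \<open>psi m\<close> is \<psi>(q^m).\<close>

definition theta :: "nat \<Rightarrow> int fps" where
  "theta m = gf UNIV (\<lambda>j. int m * j\<^sup>2) (\<lambda>_. 1)"

definition theta_alt :: "nat \<Rightarrow> int fps" where
  "theta_alt m = gf UNIV (\<lambda>j. int m * j\<^sup>2) int_sgn"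

definition psi :: "nat \<Rightarrow> int fps" where
  "psi m = gf UNIV (\<lambda>j. int m * (j * (2 * j - 1))) (\<lambda>_. 1)"

text \<open>With x = q^m, \<open>shanks_square\<close> is multiplied by (x;x)_n. The left side tends
  to f_m^2, and on the right (x;x)_n (-x;x)_n = (x^2;x^2)_n tends to f_{2m}.\<close>

theorem gauss_square:
  assumes "m > 0"
  shows "euler_f m ^ 2 = euler_f (2 * m) * theta_alt m"
proof (rule LIMSEQ_unique)
  let ?q = "fps_X ^ m :: int fps"
  let ?S = "\<lambda>n. \<Sum>s\<le>n. (-1) ^ s * qprod ?q s n * (\<Prod>k<s. 1 + ?q ^ k) * ?q ^ (s * Suc n)"
  have "?S \<longlonglongrightarrow> euler_f m"
    unfolding power_mult [symmetric, of fps_X m "_ * Suc _"]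
  proof (rule tendsto_sum_X_power)
    fix n s :: nat assume s: "0 < s"
    then have "1 * (1 * n) \<le> m * (s * Suc n)"
      using assms by (intro mult_mono) auto
    then show "n \<le> m * (s * Suc n)" by simp
  qed (use qprod_tendsto_euler_f [OF assms] in auto)
  then show "(\<lambda>n. qprod ?q 0 n * ?S n) \<longlonglongrightarrow> euler_f m ^ 2"
    unfolding power2_eq_square by (intro tendsto_mult_fps qprod_tendsto_euler_f assms)
  have "(\<lambda>n. \<Sum>j=- int n..int n. of_int (int_sgn j) * ?q ^ nat (j\<^sup>2)) \<longlonglongrightarrow> theta_alt m"
    unfolding fps_X_power_power_nat theta_alt_def
  proof (rule gf_tendsto)
    fix n :: nat and i assume "0 < n" and "int m * i\<^sup>2 \<le> int n"
    then show "i \<in> {- int n..int n}"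
      using abs_le_scaled [OF assms abs_le_square [of i]] by auto
  qed (use assms in \<open>auto intro: proper_on_scaled abs_le_square\<close>)
  moreover have "qprod ?q 0 n * ?S n = qprod (fps_X ^ (2 * m)) 0 n *
      (\<Sum>j=- int n..int n. of_int (int_sgn j) * ?q ^ nat (j\<^sup>2))" for n
  proof -
    have "qprod ?q 0 n * (\<Prod>k=1..n. 1 + ?q ^ k) = (\<Prod>k=1..n. (1 - ?q ^ k) * (1 + ?q ^ k))"
      unfolding qprod_def prod.distrib atLeastSucAtMost_greaterThanAtMost [symmetric] by simp
    also have "\<dots> = qprod (fps_X ^ (2 * m)) 0 n"
      unfolding qprod_def atLeastSucAtMost_greaterThanAtMost [symmetric]
      by (simp add: algebra_simps mult_2_right power_add power_mult_distrib)
    finally show ?thesis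
      unfolding shanks_square by (simp only: mult.assoc [symmetric])
  qed
  ultimately show "(\<lambda>n. qprod ?q 0 n * ?S n) \<longlonglongrightarrow> euler_f (2 * m) * theta_alt m"
    using assms by (simp only:) (intro tendsto_mult_fps qprod_tendsto_euler_f; simp)
qed

text \<open>With x = q^m, \<open>shanks_triangular\<close> is multiplied by (x^2;x^2)_n. The left
  side tends to f_{2m}^2; on the right the even and odd factors combine to (x;x)_{2n}, which tends
  to f_m.\<close>

theorem gauss_triangular:
  assumes "m > 0"
  shows "euler_f m * psi m = euler_f (2 * m) ^ 2"
proof (rule LIMSEQ_unique)
  let ?q = "fps_X ^ m :: int fps"
  let ?S = "\<lambda>n. \<Sum>s<n. qprod (?q\<^sup>2) s n * (\<Prod>k<s. 1 - ?q ^ (2 * k + 1)) * ?q ^ (s * (2 * n + 1))"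
  have q2: "?q\<^sup>2 = fps_X ^ (2 * m)"
    by (simp add: power_mult [symmetric] mult.commute)
  have "?S \<longlonglongrightarrow> euler_f (2 * m)"
    unfolding power_mult [symmetric, of fps_X m "_ * (2 * _ + 1)"]
  proof (rule tendsto_sum_X_power)
    fix n s :: nat assume s: "0 < s"
    then have "1 * (1 * n) \<le> m * (s * (2 * n + 1))"
      using assms by (intro mult_mono) auto
    then show "n \<le> m * (s * (2 * n + 1))" by simp
  qed (use qprod_tendsto_euler_f [of "2 * m"] assms in \<open>auto simp: q2\<close>)
  then show "(\<lambda>n. qprod (?q\<^sup>2) 0 n * ?S n) \<longlonglongrightarrow> euler_f (2 * m) ^ 2"
    unfolding power2_eq_square [of "euler_f _"] q2 using assms
    by (intro tendsto_mult_fps qprod_tendsto_euler_f) auto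
  have "(\<lambda>n. \<Sum>j=1 - int n..int n. ?q ^ nat (j * (2 * j - 1))) \<longlonglongrightarrow> psi m"
  proof -
    have "(\<lambda>n. \<Sum>j=1 - int n..int n. of_int 1 * fps_X ^ nat (int m * (j * (2 * j - 1)))) \<longlonglongrightarrow> psi m"
      unfolding psi_def
    proof (rule gf_tendsto)
      fix n :: nat and i assume n: "0 < n" and le: "int m * (i * (2 * i - 1)) \<le> int n"
      \<comment> \<open>The window leaves out \<open>- int n\<close>, so
        \<open>\<bar>i\<bar> \<le> int n\<close> is too weak; for negative \<open>i\<close> this
        exponent is at least \<open>3 * \<bar>i\<bar>\<close>.\<close>
      have "int n \<ge> i * (2 * i - 1)"
      proof -
        have "0 \<le> i * (2 * i - 1)" using abs_le_hexagonal [of i] by linarith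
        then have "1 * (i * (2 * i - 1)) \<le> int m * (i * (2 * i - 1))"
          using assms by (intro mult_right_mono) auto
        with le show ?thesis by simp
      qed
      moreover have "\<bar>i\<bar> \<le> i\<^sup>2" by (rule abs_le_square)
      ultimately show "i \<in> {1 - int n..int n}"
        by (cases "i = 0") (use n in \<open>auto simp: algebra_simps power2_eq_square\<close>)
    qed (use assms in \<open>auto intro: proper_on_scaled abs_le_hexagonal\<close>)
    then show ?thesis
      by (simp add: fps_X_power_power_nat)
  qed
  moreover have "qprod (?q\<^sup>2) 0 n * ?S n =
      qprod ?q 0 (2 * n) * (\<Sum>j=1 - int n..int n. ?q ^ nat (j * (2 * j - 1)))" for n
  proof -
    have "qprod (?q\<^sup>2) 0 n * (\<Prod>k<n. 1 - ?q ^ (2 * k + 1)) = qprod ?q 0 (2 * n)"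
    proof (induction n)
      case (Suc n)
      have "qprod (?q\<^sup>2) 0 (Suc n) * (\<Prod>k<Suc n. 1 - ?q ^ (2 * k + 1)) =
        (qprod (?q\<^sup>2) 0 n * (\<Prod>k<n. 1 - ?q ^ (2 * k + 1))) * (1 - ?q ^ (2 * n + 1)) * (1 - (?q\<^sup>2) ^ Suc n)"
        by (simp only: qprod_Suc_right prod.lessThan_Suc le0 ac_simps)
      also have "(?q\<^sup>2) ^ Suc n = ?q ^ Suc (Suc (2 * n))"
        unfolding power_mult [symmetric] by (simp add: algebra_simps)
      finally show ?case
        unfolding Suc mult_Suc_right [of 2] add_2_eq_Suc qprod_Suc_right [OF le0]
        by (simp only: Suc_eq_plus1 [symmetric])
    qed simp
    then show ?thesis
      unfolding shanks_triangular by (simp only: mult.assoc [symmetric])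
  qed
  moreover have "(\<lambda>n. qprod ?q 0 (2 * n)) \<longlonglongrightarrow> euler_f m"
    by (rule filterlim_compose [OF qprod_tendsto_euler_f [OF assms]])
      (auto intro: filterlim_subseq simp: strict_mono_def)
  ultimately show "(\<lambda>n. qprod (?q\<^sup>2) 0 n * ?S n) \<longlonglongrightarrow> euler_f m * psi m"
    by (simp only:) (intro tendsto_mult_fps; simp)
qed

section \<open>Quadratic identities between theta functions\<close>

text \<open>
  The exponents of \<^const>\<open>psi\<close> are the hexagonal numbers, which run through the triangular numbers
  without repetition; those of \<open>omega\<close> run through twice each triangular number, hitting each one twice.
\<close>

definition omega :: "nat \<Rightarrow> int fps" where
  "omega m = gf UNIV (\<lambda>j. int m * (j * (j + 1))) (\<lambda>_. 1)"

lemma proper_on_omega: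
  assumes "m > 0"
  shows "proper_on UNIV (\<lambda>j. int m * (j * (j + 1)))"
proof (rule proper_onI_abs)
  fix j :: int
  have nonneg: "0 \<le> j * (j + 1)"
    using abs_le_square [of j] by (simp add: algebra_simps power2_eq_square)
  then show "0 \<le> int m * (j * (j + 1))" by simp
  have "1 * (j * (j + 1)) \<le> int m * (j * (j + 1))"
    using assms nonneg by (intro mult_right_mono) auto
  moreover have "\<bar>j\<bar> \<le> j * (j + 1) + 1"
  proof -
    have "\<bar>j + 1\<bar> \<le> (j + 1)\<^sup>2" by (rule abs_le_square)
    then show ?thesis
      using abs_le_square [of j] by (simp add: algebra_simps power2_eq_square)
  qed
  ultimately show "\<bar>j\<bar> \<le> int m * (j * (j + 1)) + 1" by linarith
qed

lemma omega_eq_psi: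
  assumes "m > 0"
  shows "omega m = 2 * psi (2 * m)"
proof -
  let ?e = "\<lambda>j. int m * (j * (j + 1))"
  have U: "UNIV = {j::int. even j} \<union> {j. odd j}" by auto
  \<comment> \<open>Both \<open>j = - 2 * t\<close> and \<open>j = 2 * t - 1\<close> turn
    \<open>j * (j + 1)\<close> into \<open>2 * (t * (2 * t - 1))\<close>.\<close>
  have "gf {j. even j} ?e (\<lambda>_. 1) = psi (2 * m)"
    unfolding psi_def
    by (rule gf_reindex [of "\<lambda>t. - 2 * t"])
      (auto simp: inj_on_def algebra_simps elim!: evenE intro: exI [of _ "- _"])
  moreover have "gf {j. odd j} ?e (\<lambda>_. 1) = psi (2 * m)"
    unfolding psi_def
    by (rule gf_reindex [of "\<lambda>t. 2 * t - 1"])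
      (auto simp: inj_on_def algebra_simps elim!: oddE intro: exI [of _ "_ + 1"])
  moreover have "gf ({j. even j} \<union> {j. odd j}) ?e (\<lambda>_. 1) = gf {j. even j} ?e (\<lambda>_. 1) + gf {j. odd j} ?e (\<lambda>_. 1)"
    by (rule gf_Un) (use proper_on_omega [OF assms] in \<open>auto simp flip: U\<close>)
  ultimately show ?thesis
    unfolding omega_def U by simp
qed

text \<open>The lattice of pairs (a, b) is rotated by 45 degrees. For a + b even, a = u + v and b =
  u - v give 2u^2 + 2v^2 with sign +. For a + b odd, a = u + v + 1 and b = u - v give 2u(u + 1) +
  2v(v + 1) + 1 with sign -.\<close>

lemma theta_alt_square:
  assumes "m > 0"
  shows "theta_alt m ^ 2 = theta (2 * m) ^ 2 - 4 * fps_X ^ m * psi (4 * m) ^ 2"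
proof -
  let ?E = "\<lambda>(a, b). int m * a\<^sup>2 + int m * b\<^sup>2" and ?W = "\<lambda>(a, b). int_sgn a * int_sgn b"
  define Ev Od where "Ev = {(a::int, b::int). even (a + b)}" and "Od = {(a::int, b::int). odd (a + b)}"
  have U: "UNIV \<times> UNIV = Ev \<union> Od" by (auto simp: Ev_def Od_def)
  have pr: "proper_on UNIV (\<lambda>j. int k * j\<^sup>2)" if "k > 0" for k
    using that by (rule proper_on_scaled) (rule abs_le_square)
  have "theta_alt m ^ 2 = gf (UNIV \<times> UNIV) ?E ?W"
    unfolding power2_eq_square [of "theta_alt m"] unfolding theta_alt_def by (intro gf_mult pr assms)
  also have "\<dots> = gf Ev ?E ?W + gf Od ?E ?W"
    unfolding U
  proof (rule gf_Un)
    show "proper_on (Ev \<union> Od) ?E"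
      unfolding U [symmetric] by (intro proper_on_Times pr assms)
  qed (auto simp: Ev_def Od_def)
  also have "gf Ev ?E ?W = gf (UNIV \<times> UNIV)
      (\<lambda>(u, v). int (2 * m) * u\<^sup>2 + int (2 * m) * v\<^sup>2) (\<lambda>(u, v). 1 * 1)"
  proof (rule gf_reindex [of "\<lambda>(u, v). (u + v, u - v)"], goal_cases)
    case (3 p)
    obtain a b where p: "p = (a, b)" by (cases p)
    with 3 have "even (a + b)" by (simp add: Ev_def)
    then obtain n where "a + b = 2 * n" by (elim evenE)
    with p show ?case by (intro bexI [of _ "(n, n - b)"]) auto
  qed (auto simp: Ev_def int_sgn_def inj_on_def algebra_simps power2_eq_square)
  also have "\<dots> = theta (2 * m) ^ 2"
    unfolding power2_eq_square [of "theta (2 * m)"]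
    unfolding theta_def
    by (intro gf_mult [symmetric] pr) (use assms in auto)
  also have "gf Od ?E ?W = gf (UNIV \<times> UNIV)
      (\<lambda>p. (\<lambda>(u, v). int (2 * m) * (u * (u + 1)) + int (2 * m) * (v * (v + 1))) p + int m)
      (\<lambda>p. - (\<lambda>(u, v). 1 * 1) p)"
  proof (rule gf_reindex [of "\<lambda>(u, v). (u + v + 1, u - v)"], goal_cases)
    case (3 p)
    obtain a b where p: "p = (a, b)" by (cases p)
    with 3 have "odd (a + b)" by (simp add: Od_def)
    then obtain n where "a + b = 2 * n + 1" by (elim oddE)
    with p show ?case by (intro bexI [of _ "(n, n - b)"]) auto
  qed (auto simp: Od_def int_sgn_def inj_on_def algebra_simps power2_eq_square)
  also have "\<dots> = - (fps_X ^ m * omega (2 * m) ^ 2)"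
    unfolding power2_eq_square [of "omega (2 * m)"]
    unfolding omega_def gf_uminus
    by (subst gf_mult; (subst gf_shift)?; (intro proper_on_Times)?; (intro proper_on_omega)?) (use assms in auto)
  finally show ?thesis
    using assms by (simp add: omega_eq_psi power_mult_distrib algebra_simps)
qed

text \<open>With s = j + k and t = j - k the exponent is m (t^2 + s(s - 1)), where s and t have
  equal parity. Putting s = 2c for even t and s = 1 - 2c for odd t gives s(s - 1) = 2c(2c - 1) in
  both cases, so t and c range freely.\<close>

lemma psi_square:
  assumes "m > 0"
  shows "psi m ^ 2 = theta m * psi (2 * m)"
proof -
  have ps: "proper_on UNIV (\<lambda>j. int k * (j * (2 * j - 1)))" if "k > 0" for k
    using that by (rule proper_on_scaled) (rule abs_le_hexagonal)
  have th: "proper_on UNIV (\<lambda>j. int m * j\<^sup>2)"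
    using assms by (rule proper_on_scaled) (rule abs_le_square)
  have "psi m ^ 2 = gf (UNIV \<times> UNIV)
      (\<lambda>(j, k). int m * (j * (2 * j - 1)) + int m * (k * (2 * k - 1))) (\<lambda>(j, k). 1 * 1)"
    unfolding power2_eq_square [of "psi m"] unfolding psi_def by (intro gf_mult ps assms)
  also have "\<dots> = gf (UNIV \<times> UNIV)
      (\<lambda>(t, j). int m * t\<^sup>2 + int (2 * m) * (j * (2 * j - 1))) (\<lambda>(t, j). 1 * 1)"
  proof (rule gf_reindex [of "\<lambda>(t, j). if even t then (j + t div 2, j - t div 2)
      else (1 - j + t div 2, - j - t div 2)"], goal_cases)
    case 1
    show ?case
    proof (rule inj_on_inverseI [where g = "\<lambda>(j, k). (j - k,
        if even (j - k) then k + (j - k) div 2 else - k - (j - k) div 2)"])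
      fix p :: "int \<times> int"
      obtain t j where p: "p = (t, j)" by (cases p)
      show "(\<lambda>(j, k). (j - k, if even (j - k) then k + (j - k) div 2 else - k - (j - k) div 2))
        ((\<lambda>(t, j). if even t then (j + t div 2, j - t div 2) else (1 - j + t div 2, - j - t div 2)) p) = p"
      proof (cases "even t")
        case True
        then obtain r where "t = 2 * r" by (elim evenE)
        then show ?thesis by (simp add: p)
      next
        case False
        then obtain r where t: "t = 2 * r + 1" by (elim oddE)
        have h: "(if even t then (j + t div 2, j - t div 2) else (1 - j + t div 2, - j - t div 2)) =
          (1 - j + r, - j - r)" and d: "1 - j + r - (- j - r) = 2 * r + 1"
          by (simp_all add: t)
        show ?thesis unfolding p prod.case h d by (simp add: t)
      qed
    qed
  next
    case (3 p)
    obtain j k where p: "p = (j, k)" by (cases p)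
    show ?case
    proof (cases "even (j - k)")
      case True
      then obtain r where "j - k = 2 * r" by (elim evenE)
      then show ?thesis by (intro bexI [of _ "(2 * r, k + r)"]) (auto simp: p)
    next
      case False
      then obtain r where "j - k = 2 * r + 1" by (elim oddE)
      then show ?thesis by (intro bexI [of _ "(2 * r + 1, - k - r)"]) (auto simp: p)
    qed
  next
    case (4 p)
    obtain t j where p: "p = (t, j)" by (cases p)
    show ?case
    proof (cases "even t")
      case True
      then obtain r where "t = 2 * r" by (elim evenE)
      then show ?thesis by (simp add: p algebra_simps power2_eq_square)
    next
      case False
      then obtain r where "t = 2 * r + 1" by (elim oddE)
      then show ?thesis by (simp add: p algebra_simps power2_eq_square)
    qed
  qed auto
  also have "\<dots> = theta m * psi (2 * m)"
    unfolding psi_def theta_def by (intro gf_mult [symmetric] ps th) (use assms in auto)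
  finally show ?thesis .
qed

section \<open>The theta expansion of \<open>f\<^sub>1 f\<^sub>5\<close>\<close>

text \<open>Built on the norm of a + b sqrt(-5), which is 1 mod 4 when a + b is odd, so that the
  division is exact there.\<close>

definition norm5_index :: "(int \<times> int) \<Rightarrow> int" where
  "norm5_index = (\<lambda>(a, b). (a\<^sup>2 + 5 * b\<^sup>2 - 1) div 4)"

lemma norm5_index_eq: "a\<^sup>2 + 5 * b\<^sup>2 - 1 = 4 * N \<Longrightarrow> norm5_index (a, b) = N"
  by (simp add: norm5_index_def)

lemma proper_on_norm5_index: "proper_on {(a, b). odd (a + b)} norm5_index"
  unfolding proper_on_def
proof (intro conjI ballI allI)
  fix p :: "int \<times> int"
  obtain a b where p: "p = (a, b)" by (cases p)
  assume "p \<in> {(a, b). odd (a + b)}"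
  then have "a \<noteq> 0 \<or> b \<noteq> 0" by (auto simp: p)
  then have "1 \<le> \<bar>a\<bar> + \<bar>b\<bar>" by linarith
  then have "1 \<le> a\<^sup>2 + 5 * b\<^sup>2"
    using abs_le_square [of a] abs_le_square [of b] by linarith
  then show "0 \<le> norm5_index p"
    by (simp add: norm5_index_def p)
next
  fix N :: nat
  have "{p \<in> {(a, b). odd (a + b)}. norm5_index p = int N} \<subseteq>
    {- int (4 * N + 4)..int (4 * N + 4)} \<times> {- int (4 * N + 4)..int (4 * N + 4)}"
  proof
    fix p :: "int \<times> int"
    obtain a b where p: "p = (a, b)" by (cases p)
    assume "p \<in> {p \<in> {(a, b). odd (a + b)}. norm5_index p = int N}"
    then have "a\<^sup>2 + 5 * b\<^sup>2 - 1 \<le> 4 * int N + 3"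
      by (auto simp: norm5_index_def p)
    then have "\<bar>a\<bar> \<le> 4 * int N + 4" "\<bar>b\<bar> \<le> 4 * int N + 4"
      using abs_le_square [of a] abs_le_square [of b] by linarith+
    then show "p \<in> {- int (4 * N + 4)..int (4 * N + 4)} \<times> {- int (4 * N + 4)..int (4 * N + 4)}"
      by (auto simp: p)
  qed
  then show "finite {p \<in> {(a, b). odd (a + b)}. norm5_index p = int N}"
    by (rule finite_subset) simp
qed

text \<open>First of two evaluations of this series, by which coordinate is odd. Odd b brings the
  sign and, from 5(2n + 1)^2 = 20n(n + 1) + 5, the factor q.\<close>

lemma norm5_series_parity_split:
  "gf {(a, b). odd (a + b)} norm5_index (\<lambda>(a, b). int_sgn b) =
    omega 1 * theta 5 - fps_X * (theta 1 * omega 5)"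
proof -
  let ?W = "\<lambda>(a, b). int_sgn b"
  define S T where "S = {(a::int, b::int). odd a \<and> even b}" and "T = {(a::int, b::int). even a \<and> odd b}"
  have U: "{(a, b). odd (a + b)} = S \<union> T" by (auto simp: S_def T_def)
  have th: "proper_on UNIV (\<lambda>j. int k * j\<^sup>2)" if "k > 0" for k
    using that by (rule proper_on_scaled) (rule abs_le_square)
  have "gf (S \<union> T) norm5_index ?W = gf S norm5_index ?W + gf T norm5_index ?W"
  proof (rule gf_Un)
    show "proper_on (S \<union> T) norm5_index"
      using proper_on_norm5_index unfolding U .
  qed (auto simp: S_def T_def)
  also have "gf S norm5_index ?W = gf (UNIV \<times> UNIV)
      (\<lambda>(m, n). int 1 * (m * (m + 1)) + int 5 * n\<^sup>2) (\<lambda>(m, n). 1 * 1)"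
  proof (rule gf_reindex [of "\<lambda>(m, n). (2 * m + 1, 2 * n)"], goal_cases)
    case (3 p)
    then obtain a b m n where "p = (a, b)" "a = 2 * m + 1" "b = 2 * n"
      by (auto simp: S_def elim!: evenE oddE)
    then show ?case by (intro bexI [of _ "(m, n)"]) auto
  qed (auto simp: S_def int_sgn_def inj_on_def algebra_simps power2_eq_square intro!: norm5_index_eq)
  also have "\<dots> = omega 1 * theta 5"
    unfolding omega_def theta_def by (intro gf_mult [symmetric] th proper_on_omega) auto
  also have "gf T norm5_index ?W = gf (UNIV \<times> UNIV)
      (\<lambda>p. (\<lambda>(m, n). int 1 * m\<^sup>2 + int 5 * (n * (n + 1))) p + int 1) (\<lambda>p. - (\<lambda>(m, n). 1 * 1) p)"
  proof (rule gf_reindex [of "\<lambda>(m, n). (2 * m, 2 * n + 1)"], goal_cases)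
    case (3 p)
    then obtain a b m n where "p = (a, b)" "a = 2 * m" "b = 2 * n + 1"
      by (auto simp: T_def elim!: evenE oddE)
    then show ?case by (intro bexI [of _ "(m, n)"]) auto
  qed (auto simp: T_def int_sgn_def inj_on_def algebra_simps power2_eq_square intro!: norm5_index_eq)
  also have "\<dots> = - (fps_X ^ 1 * (theta 1 * omega 5))"
    unfolding omega_def theta_def gf_uminus
    by (subst gf_mult; (subst gf_shift)?; (intro proper_on_Times)?; (intro proper_on_omega th)?) auto
  finally show ?thesis
    unfolding U by simp
qed

text \<open>
  The substitution below is \<open>(6m + 1) + (6n + 1) \<surd>-5 = (1 + \<surd>-5) (a + b \<surd>-5)\<close>; it maps \<open>\<int>\<^sup>2\<close> onto the class
  \<open>a + b \<equiv> 1 (mod 6)\<close>. The class of \<open>5\<close> is its negative, and in the class of \<open>3\<close> the reflection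
  \<open>m \<mapsto> - 1 - m\<close> reverses the sign of every term.
\<close>

lemma norm5_series_mod_6_split:
  "gf {(a, b). odd (a + b)} norm5_index (\<lambda>(a, b). int_sgn b) = 2 * (euler_f 1 * euler_f 5)"
proof -
  let ?W = "\<lambda>(a, b). int_sgn b"
  define S :: "int \<Rightarrow> (int \<times> int) set" where "S = (\<lambda>r. {(a, b). (a + b) mod 6 = r})"
  have U: "{(a, b). odd (a + b)} = (S 1 \<union> S 5) \<union> S 3"
    unfolding S_def by auto presburger+
  have pr: "proper_on ((S 1 \<union> S 5) \<union> S 3) norm5_index"
    using proper_on_norm5_index unfolding U .
  then have pr': "proper_on (S 1 \<union> S 5) norm5_index"
    by (auto simp: proper_on_def Int_def conj_disj_distribR Collect_disj_eq)
  have mod6: "\<exists>n. a + b = 6 * n + r" if "(a, b) \<in> S r" for a b r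
    using that by (intro exI [of _ "(a + b) div 6"]) (auto simp: S_def)
  have "gf ((S 1 \<union> S 5) \<union> S 3) norm5_index ?W =
      gf (S 1) norm5_index ?W + gf (S 5) norm5_index ?W + gf (S 3) norm5_index ?W"
    by (subst gf_Un [OF pr], force simp: S_def, subst gf_Un [OF pr']) (auto simp: S_def)
  also have "gf (S 5) norm5_index ?W = gf (S 1) norm5_index ?W"
  proof (rule gf_reindex [of "\<lambda>(a, b). (- a, - b)"], goal_cases)
    case (2 p)
    then show ?case by (auto simp: S_def) presburger
  next
    case (3 p)
    obtain a b where p: "p = (a, b)" by (cases p)
    from 3 have "(- a, - b) \<in> S 1" by (auto simp: p S_def) presburger
    then show ?case by (intro bexI [of _ "(- a, - b)"]) (auto simp: p)
  qed (auto simp: norm5_index_def int_sgn_def inj_on_def)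
  also have "gf (S 1) norm5_index ?W = gf (UNIV \<times> UNIV)
      (\<lambda>(m, n). int 1 * pent m + int 5 * pent n) (\<lambda>(m, n). int_sgn m * int_sgn n)"
  proof (rule gf_reindex [of "\<lambda>(m, n). (5 * n + m + 1, n - m)"], goal_cases)
    case (3 p)
    obtain a b where p: "p = (a, b)" by (cases p)
    with 3 obtain n where "a + b = 6 * n + 1" using mod6 by blast
    then show ?case by (intro bexI [of _ "(n - b, n)"]) (auto simp: p)
  next
    case (4 p)
    obtain m n where p: "p = (m, n)" by (cases p)
    \<comment> \<open>Norms in the substitution give 6(a^2 + 5b^2) = (6m + 1)^2 + 5(6n + 1)^2, and
      (6m + 1)^2 = 24 \<open>pent m\<close> + 1.\<close>
    have "norm5_index (5 * n + m + 1, n - m) = int 1 * pent m + int 5 * pent n"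
      by (rule norm5_index_eq) (use pent_double [of m] pent_double [of n] in \<open>simp add: algebra_simps power2_eq_square\<close>)
    then show ?case by (simp add: p)
  qed (auto simp: S_def int_sgn_def inj_on_def algebra_simps)
  also have "\<dots> = euler_f 1 * euler_f 5"
    unfolding euler_pentagonal [OF zero_less_one] euler_pentagonal [OF zero_less_numeral]
    by (intro gf_mult [symmetric] proper_on_scaled abs_le_pent) auto
  also have "gf (S 3) norm5_index ?W = 0"
  proof -
    define e where "e = (\<lambda>(m, n). norm5_index (5 * n + m + 3, n - m))"
    define w where "w = (\<lambda>(m, n). int_sgn (n - m))"
    have S3: "gf (S 3) norm5_index ?W = gf UNIV e w"
    proof (rule gf_reindex [of "\<lambda>(m, n). (5 * n + m + 3, n - m)"], goal_cases)
      case (3 p)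
      obtain a b where p: "p = (a, b)" by (cases p)
      with 3 obtain n where "a + b = 6 * n + 3" using mod6 by blast
      then show ?case by (intro bexI [of _ "(n - b, n)"]) (auto simp: p)
    qed (auto simp: S_def e_def w_def inj_on_def algebra_simps)
    \<comment> \<open>For a = 5n + m + 3 and b = n - m the reflection negates a - 5b = 6m + 3 and
      fixes a + b = 6n + 3. So a^2 + 5b^2 is preserved, while the parity of b changes.\<close>
    have "gf UNIV e w = - gf UNIV e w"
      unfolding gf_uminus [symmetric]
    proof (rule gf_reindex [of "\<lambda>(m, n). (- 1 - m, n)"], goal_cases)
      case (3 p)
      show ?case
        by (intro bexI [of _ "(- 1 - fst p, snd p)"]) (auto simp: case_prod_beta)
    qed (auto simp: e_def w_def norm5_index_def int_sgn_def inj_on_def algebra_simps power2_eq_square)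
    then have "2 * gf UNIV e w = 0"
      unfolding mult_2 by (rule eq_neg_iff_add_eq_0 [THEN iffD1])
    with S3 show ?thesis by simp
  qed
  finally show ?thesis
    unfolding U by simp
qed

text \<open>Equates the two evaluations. The factor 2 that cancels comes from the classes 1 and 5 on
  one side and from \<open>omega_eq_psi\<close> on the other.\<close>

theorem euler_f_1_5:
  "euler_f 1 * euler_f 5 = psi 2 * theta 5 - fps_X * (theta 1 * psi 10)"
proof -
  have "2 * (euler_f 1 * euler_f 5) = 2 * (psi 2 * theta 5 - fps_X * (theta 1 * psi 10))"
    using norm5_series_parity_split unfolding norm5_series_mod_6_split
    by (simp add: omega_eq_psi algebra_simps del: One_nat_def)
  then show ?thesis by (subst (asm) mult_cancel_left) simp
qed

section \<open>Substituting q^2 for q\<close>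

lemma euler_f_compose:
  assumes "m > 0"
  shows "euler_f m oo fps_X ^ 2 = euler_f (2 * m)"
  using assms by (simp add: euler_pentagonal gf_compose_X_power mult.assoc)

lemma theta_compose: "theta m oo fps_X ^ 2 = theta (2 * m)"
  by (simp add: theta_def gf_compose_X_power mult.assoc)

lemma psi_compose: "psi m oo fps_X ^ 2 = psi (2 * m)"
  by (simp add: psi_def gf_compose_X_power mult.assoc)

lemma fps_nth_odd_dissection:
  fixes U V :: "'a::comm_ring_1 fps"
  shows "fps_nth ((U oo fps_X ^ 2) + fps_X * (V oo fps_X ^ 2)) (2 * n + 1) = fps_nth V n"
  by (simp add: fps_nth_compose_X_power)

section \<open>The Hecke relation at 2\<close>

definition cusp45 :: "int fps" where
  "cusp45 = euler_f 1 ^ 4 * euler_f 5 ^ 4"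

text \<open>This is the relation for c(2N) at N = n + 1, before the shift by q; the last coefficient
  is c(N/2), or 0 for odd N.\<close>

lemma cusp45_odd_nth:
  "fps_nth cusp45 (2 * n + 1) =
    - 4 * fps_nth cusp45 n - 8 * fps_nth (fps_X * (cusp45 oo fps_X ^ 2)) n"
proof -
  define p where "p = euler_f 1 * euler_f 5"
  \<comment> \<open>Even and odd parts, with q^2 renamed to q. The odd terms of (A - 4qB)(C - 4q^5
    D) are -4qBC and -4q^5 AD; taking out q and halving leaves the powers 0 and 2 in
    \<open>V\<close>.\<close>
  define U where "U = p ^ 2 * (theta 1 ^ 2 * theta 5 ^ 2 + 16 * fps_X ^ 3 * (psi 2 ^ 2 * psi 10 ^ 2))"
  define V where "V = - 4 * p ^ 2 * (psi 2 ^ 2 * theta 5 ^ 2 + fps_X ^ 2 * (theta 1 ^ 2 * psi 10 ^ 2))"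
  have X0: "fps_nth (fps_X ^ 2 :: int fps) 0 = 0" by simp
  note distribs = fps_compose_mult_distrib [OF X0] fps_compose_power [OF X0, symmetric]
    fps_compose_add_distrib fps_compose_sub_distrib fps_compose_uminus
  have numeral_compose: "numeral k oo fps_X ^ 2 = (numeral k :: int fps)" for k
    by (simp only: numeral_fps_const fps_const_compose)
  have expand: "(a - 4 * x * b) * (c - 4 * x ^ 5 * d) =
      (a * c + 16 * x ^ 6 * (b * d)) - x * (4 * (b * c + x ^ 4 * (a * d)))" for a b c d x :: "int fps"
    by (simp add: algebra_simps eval_nat_numeral)
  have "cusp45 = (euler_f 1 ^ 2) ^ 2 * (euler_f 5 ^ 2) ^ 2"
    by (simp add: cusp45_def flip: power_mult)
  also have "\<dots> = (euler_f 2 * euler_f 10) ^ 2 * (theta_alt 1 ^ 2 * theta_alt 5 ^ 2)"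
    using gauss_square [of 1] gauss_square [of 5] by (simp add: power_mult_distrib algebra_simps del: One_nat_def)
  also have "\<dots> = (euler_f 2 * euler_f 10) ^ 2 * ((theta 2 ^ 2 - 4 * fps_X * psi 4 ^ 2) *
      (theta 10 ^ 2 - 4 * fps_X ^ 5 * psi 20 ^ 2))"
    using theta_alt_square [of 1] theta_alt_square [of 5] by (simp del: One_nat_def)
  also have "\<dots> = (U oo fps_X ^ 2) + fps_X * (V oo fps_X ^ 2)"
    by (simp add: U_def V_def p_def distribs numeral_compose euler_f_compose theta_compose psi_compose del: One_nat_def)
      (simp add: power_mult [symmetric] expand, simp add: algebra_simps eval_nat_numeral)
  finally have dissected: "cusp45 = (U oo fps_X ^ 2) + fps_X * (V oo fps_X ^ 2)" .
  have "fps_nth cusp45 (2 * n + 1) = fps_nth V n"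
    by (subst dissected) (rule fps_nth_odd_dissection)
  \<comment> \<open>x^2 + y^2 = (x - y)^2 + 2xy, where x - y is f_1 f_5 by
    \<open>euler_f_1_5\<close> and the factors of xy regroup for \<open>psi_square\<close>.\<close>
  also have "V = - 4 * p ^ 2 * ((psi 2 * theta 5 - fps_X * (theta 1 * psi 10)) ^ 2 +
      2 * fps_X * (theta 1 * psi 2) * (theta 5 * psi 10))"
    unfolding V_def by (simp add: algebra_simps power2_eq_square)
  also have "\<dots> = - 4 * p ^ 2 * (p ^ 2 + 2 * fps_X * psi 1 ^ 2 * psi 5 ^ 2)"
    using psi_square [of 1] psi_square [of 5] by (simp add: euler_f_1_5 p_def mult.assoc del: One_nat_def)
  also have "\<dots> = - 4 * cusp45 - 8 * (fps_X * ((euler_f 1 * psi 1) ^ 2 * (euler_f 5 * psi 5) ^ 2))"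
    unfolding cusp45_def p_def by (simp add: algebra_simps eval_nat_numeral)
  also have "(euler_f 1 * psi 1) ^ 2 * (euler_f 5 * psi 5) ^ 2 = cusp45 oo fps_X ^ 2"
    using gauss_triangular [of 1] gauss_triangular [of 5]
    by (simp add: cusp45_def distribs euler_f_compose flip: power_mult del: One_nat_def)
  finally show ?thesis
    by (simp add: numeral_fps_const)
qed

section \<open>From the Hecke relation to the congruences\<close>

definition hecke_coeff :: "nat \<Rightarrow> int" where
  "hecke_coeff = fps_nth (fps_X * cusp45)"

lemma hecke_coeff_Suc: "hecke_coeff (Suc n) = P_star n"
  by (simp add: hecke_coeff_def cusp45_def P_star_def)

lemma hecke_coeff_double:
  "hecke_coeff (2 * n) = - 4 * hecke_coeff n - 8 * (if even n then hecke_coeff (n div 2) else 0)"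
proof (cases n)
  case 0
  then show ?thesis by (simp add: hecke_coeff_def)
next
  case (Suc k)
  \<comment> \<open>One more factor q turns q \<open>cusp45\<close>(q^2) into the newform at q^2,
    which moves the index from \<open>k\<close> to \<open>Suc k\<close>.\<close>
  have "fps_nth (fps_X * (cusp45 oo fps_X ^ 2)) k = fps_nth (fps_X * cusp45 oo fps_X ^ 2) (Suc k)"
    by (simp add: fps_compose_mult_distrib power2_eq_square [of fps_X] mult.assoc)
  also have "\<dots> = (if even n then hecke_coeff (n div 2) else 0)"
    by (simp only: fps_nth_compose_X_power hecke_coeff_def Suc)
  finally show ?thesis
    using cusp45_odd_nth [of k] by (simp add: hecke_coeff_def Suc)
qed

text \<open>With d for the conditional term, c(2n) = -4c(n) - 8d and c(4n) = 8c(n) + 32d; in c(8n) =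
  -4c(4n) - 8c(2n) the terms c(n) cancel.\<close>

lemma hecke_coeff_8: "hecke_coeff (8 * n) = - 64 * (if even n then hecke_coeff (n div 2) else 0)"
  using hecke_coeff_double [of n] hecke_coeff_double [of "2 * n"] hecke_coeff_double [of "4 * n"]
  by simp

lemma hecke_coeff_16_power: "hecke_coeff (16 ^ k * n) = (- 64) ^ k * hecke_coeff n"
proof (induction k)
  case (Suc k)
  have "hecke_coeff (16 ^ Suc k * n) = hecke_coeff (8 * (2 * (16 ^ k * n)))" by (simp add: mult.assoc)
  also have "\<dots> = - 64 * hecke_coeff (16 ^ k * n)" unfolding hecke_coeff_8 by simp
  finally show ?case using Suc by simp
qed simp

lemma P_star_nat:
  assumes "x = int a - 1" "a > 0"
  shows "P_star (nat x) = hecke_coeff a"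
  using assms by (cases a) (simp_all add: hecke_coeff_Suc)

theorem theorem1p2:
  fixes k :: nat and n :: int
  assumes "n \<ge> -1"
  shows "[P_star (nat (2 ^ (4 * k) * n + 2 ^ (4 * k + 1) - 1)) = 0] (mod 2 ^ (6 * k)) \<and>
         [P_star (nat (2 ^ (4 * k + 1) * n + 2 ^ (4 * k + 2) - 1)) = 0] (mod 2 ^ (6 * k + 2)) \<and>
         [P_star (nat (2 ^ (4 * k + 2) * n + 2 ^ (4 * k + 3) - 1)) = 0] (mod 2 ^ (6 * k + 3)) \<and>
         [P_star (nat (2 ^ (4 * k + 3) * n + 2 ^ (4 * k + 4) - 1)) = 0] (mod 2 ^ (6 * k + 6)) \<and>
         P_star (nat (2 ^ (4 * k + 4) * n + 3 * 2 ^ (4 * k + 3) - 1)) = 0"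
proof -
  \<comment> \<open>Each index plus 1 is 16^k times m, 2m, 4m, 8m or, in the last case, 8(2n + 3) =
    8(2m - 1). As m is positive, \<open>2 * m - 1\<close> is not truncated.\<close>
  define m where "m = nat (n + 2)"
  have n: "n = int m - 2" and m: "m > 0"
    using assms by (auto simp: m_def)
  have p16: "2 ^ (k * 4) = (16::int) ^ k"
    by (simp add: power_mult mult.commute [of k])
  \<comment> \<open>\<open>(- 64) ^ k\<close> supplies \<open>2 ^ (6 * k)\<close> up to sign; only
    \<open>2 ^ j\<close> is left to the coefficient.\<close>
  have p64: "2 ^ (6 * k + j) dvd (- 64) ^ k * x" if "2 ^ j dvd x" for j and x :: int
  proof -
    have "2 ^ (6 * k + j) = (64::int) ^ k * 2 ^ j" by (simp add: power_add power_mult)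
    also have "\<dots> dvd (- 64) ^ k * x"
      using that by (intro mult_dvd_mono) (auto simp: power_minus [of "64 :: int"])
    finally show ?thesis .
  qed
  have "P_star (nat (2 ^ (4 * k) * n + 2 ^ (4 * k + 1) - 1)) = (- 64) ^ k * hecke_coeff m"
    unfolding hecke_coeff_16_power [symmetric]
    by (rule P_star_nat) (use m in \<open>simp_all add: n p16 algebra_simps power_add\<close>)
  moreover have "P_star (nat (2 ^ (4 * k + 1) * n + 2 ^ (4 * k + 2) - 1)) = (- 64) ^ k * hecke_coeff (2 * m)"
    unfolding hecke_coeff_16_power [symmetric]
    by (rule P_star_nat) (use m in \<open>simp_all add: n p16 algebra_simps power_add\<close>)
  moreover have "2 ^ 2 dvd hecke_coeff (2 * m)"
    unfolding hecke_coeff_double by (intro dvd_diff dvd_mult2) auto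
  moreover have "P_star (nat (2 ^ (4 * k + 2) * n + 2 ^ (4 * k + 3) - 1)) = (- 64) ^ k * hecke_coeff (4 * m)"
    unfolding hecke_coeff_16_power [symmetric]
    by (rule P_star_nat) (use m in \<open>simp_all add: n p16 algebra_simps power_add\<close>)
  moreover have "2 ^ 3 dvd hecke_coeff (4 * m)"
  proof -
    have "hecke_coeff (4 * m) = 8 * (hecke_coeff m + 4 * (if even m then hecke_coeff (m div 2) else 0))"
      using hecke_coeff_double [of m] hecke_coeff_double [of "2 * m"] by simp
    then show ?thesis by simp
  qed
  moreover have "P_star (nat (2 ^ (4 * k + 3) * n + 2 ^ (4 * k + 4) - 1)) = (- 64) ^ k * hecke_coeff (8 * m)"
    unfolding hecke_coeff_16_power [symmetric]
    by (rule P_star_nat) (use m in \<open>simp_all add: n p16 algebra_simps power_add\<close>)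
  moreover have "2 ^ 6 dvd hecke_coeff (8 * m)"
    unfolding hecke_coeff_8 by (intro dvd_mult2) simp
  moreover have "P_star (nat (2 ^ (4 * k + 4) * n + 3 * 2 ^ (4 * k + 3) - 1)) =
      (- 64) ^ k * hecke_coeff (8 * (2 * m - 1))"
    unfolding hecke_coeff_16_power [symmetric]
    by (rule P_star_nat) (use m in \<open>simp_all add: n p16 algebra_simps power_add of_nat_diff\<close>)
  \<comment> \<open>\<open>2 * m - 1\<close> is odd, so \<open>hecke_coeff_8\<close> takes its zero
    branch.\<close>
  moreover have "hecke_coeff (8 * (2 * m - 1)) = 0"
    unfolding hecke_coeff_8 using m by simp
  ultimately show ?thesis
    unfolding cong_0_iff using p64 [of 0 "hecke_coeff m"]
    by (simp only: p64 mult_zero_right add_0_right power_0 one_dvd simp_thms)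
qed

end
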